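(* Let $H \in \mathbb{N}$ have Zeckendorf expansion \[ H = F_{m_0} + F_{m_1} + \cdots + F_{m_k}, \] where $k \ge 0$, $m_{i-1} - m_i \ge 2$ for $1 \le i \le k$, and $m_k \ge 2$. Write \[ x_\ell = F_{m_\ell} + \cdots + F_{m_k} \quad (0 \le \ell \le k+1) \] (so $x_{k+1} = 0$), and \[ t_i = \Big\lfloor \frac{m_{i-1} - m_i + 2}{2} \Big\rfloor, \qquad \varepsilon_i = 2t_i - 1 - m_{i-1} + m_i \qquad (1 \le i \le k), \] \[ a_0 = 1, \qquad a_1 = t_1, \qquad a_{\ell+1} = t_{\ell+1} a_\ell - \varepsilon_\ell a_{\ell-1} \quad (1 \le \ell \le k-1). \] Then for $\ell = 1, 2, \ldots, k$ we have \[ A(H) = a_\ell A(x_\ell) - \varepsilon_\ell a_{\ell-1} A(x_{\ell+1}) + \sum_{i \le \ell} a_{i-1} f(t_i)\, 2^{m_{i-1} - 2t_i}. \] In particular \[ A(H) = \begin{cases} a_k \Big\lfloor \frac{2^{m_k}}{6} + \frac{m_k+1}{2} \Big\rfloor - \varepsilon_k a_{k-1} + \displaystyle\sum_{i \le k} a_{i-1} f(t_i)\, 2^{m_{i-1} - 2t_i}, & \text{if } k \ge 1,\\[2mm] \Big\lfloor \frac{2^{m_0}}{6} + \frac{m_0+1}{2} \Big\rfloor, & \text{if } k = 0. \end{cases} \]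
   Context: The Fibonacci numbers are $F_1 = F_2 = 1$, $F_{m+1} = F_m + F_{m-1}$. For $n \in \mathbb{Z}_{\ge 0}$, $R(n)$ is the number of solutions to $x_1 + \cdots + x_s = n$ with $s \in \mathbb{Z}_{\ge 0}$ and $x_1 < \cdots < x_s$ Fibonacci numbers (partitions of $n$ into distinct Fibonacci numbers; $R(0)=1$). For $H \in \mathbb{Z}$, $A(H) = \sum_{n=0}^{H} R(n)$ (so $A(H) = 0$ for $H < 0$). For $t \in \mathbb{N}$, $f(t) = 1 + \frac{2(4^{t-1} - 1)}{3}$. The Zeckendorf expansion of a positive integer is its unique representation as a sum of non-consecutive Fibonacci numbers $F_m$ with indices $m \ge 2$. Empty sums are $0$. *)

theory Defs
  imports Complex_Main "HOL-Number_Theory.Fib"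
begin

definition fib_numbers :: "nat set" where
  "fib_numbers = fib ` {1..}"

text \<open>A solution \<open>x\<^sub>1 < \<dots> < x\<^sub>s\<close>, with \<open>s \<ge> 0\<close> arbitrary, is a strictly increasing list.
  The value \<open>1 = F\<^sub>1 = F\<^sub>2\<close> can be used only once.\<close>

definition fib_R :: "nat \<Rightarrow> nat" where
  "fib_R n = card {xs :: nat list. sorted_wrt (<) xs \<and> set xs \<subseteq> fib_numbers \<and> sum_list xs = n}"

definition fib_A :: "int \<Rightarrow> nat" where
  "fib_A H = (\<Sum>n = 0..H. fib_R (nat n))"

definition zeck_f :: "nat \<Rightarrow> real" where
  "zeck_f t = 1 + 2 * (4 ^ (t - 1) - 1) / 3"

text \<open>An expansion \<open>F\<^bsub>m\<^sub>0\<^esub> + \<dots> + F\<^bsub>m\<^sub>k\<^esub>\<close> is given by its index sequence \<open>m\<close>, of which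
  only the values at \<open>0, \<dots>, k\<close> matter. The floor in \<open>zeck_t\<close> is nonnegative whenever
  \<open>m i \<le> m (i - 1)\<close>, so applying \<open>nat\<close> loses nothing there.\<close>

definition zeck_x :: "(nat \<Rightarrow> nat) \<Rightarrow> nat \<Rightarrow> nat \<Rightarrow> nat" where
  "zeck_x m k l = (\<Sum>i = l..k. fib (m i))"

definition zeck_t :: "(nat \<Rightarrow> nat) \<Rightarrow> nat \<Rightarrow> nat" where
  "zeck_t m i = nat \<lfloor>(real (m (i - 1)) - real (m i) + 2) / 2\<rfloor>"

definition zeck_eps :: "(nat \<Rightarrow> nat) \<Rightarrow> nat \<Rightarrow> int" where
  "zeck_eps m i = 2 * int (zeck_t m i) - 1 - int (m (i - 1)) + int (m i)"

fun zeck_a :: "(nat \<Rightarrow> nat) \<Rightarrow> nat \<Rightarrow> int" where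
  "zeck_a m 0 = 1"
| "zeck_a m (Suc 0) = int (zeck_t m 1)"
| "zeck_a m (Suc (Suc l)) =
     int (zeck_t m (Suc (Suc l))) * zeck_a m (Suc l) - zeck_eps m (Suc l) * zeck_a m l"

definition zeck_sum :: "(nat \<Rightarrow> nat) \<Rightarrow> nat \<Rightarrow> real" where
  "zeck_sum m l = (\<Sum>i = 1..l. real_of_int (zeck_a m (i - 1)) * zeck_f (zeck_t m i)
      * 2 powi (int (m (i - 1)) - 2 * int (zeck_t m i)))"

end

theory Submission
  imports Defs
begin

text \<open>Let \<open>N\<^sub>m(x)\<close> be the number of subsets of \<open>{F\<^sub>2, \<dots>, F\<^bsub>m-1\<^esub>}\<close> with sum at most \<open>x\<close>; since
  \<open>F\<^sub>2 + \<dots> + F\<^bsub>m-1\<^esub> = F\<^bsub>m+1\<^esub> - 2\<close>, it equals \<open>2\<^bsup>m-2\<^esup>\<close> for every \<open>x \<ge> F\<^bsub>m+1\<^esub> - 2\<close>, and it equals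
  \<open>A(x)\<close> for \<open>x < F\<^sub>m\<close>. Splitting the subsets according to whether they contain the largest
  available number gives \<open>A(F\<^sub>m + y) = A(y) + N\<^sub>m(F\<^sub>m + y)\<close> and
  \<open>N\<^bsub>m+2\<^esub>(F\<^bsub>m+2\<^esub> + y) = N\<^sub>m(F\<^sub>m + y) + N\<^sub>m(y) + 2\<^bsup>m-1\<^esup>\<close>. Hence, for \<open>y < F\<^bsub>m-1\<^esub>\<close>,
  \<open>A(F\<^bsub>m+2\<^esub> + y) = A(F\<^sub>m + y) + A(y) + 2\<^bsup>m-1\<^esup>\<close>. For \<open>y = 0\<close> this recurrence determines \<open>A(F\<^sub>m)\<close>;
  for \<open>y = x\<^bsub>i+1\<^esub>\<close> it reduces the gap between the two leading indices of \<open>x\<^sub>i\<close> to \<open>2\<close> or \<open>3\<close>. There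
  \<open>N\<^sub>m(F\<^sub>m + y)\<close> is full, and for the gap \<open>2\<close> the term \<open>N\<^sub>m(y) = A(x\<^bsub>i+1\<^esub>) - A(x\<^bsub>i+2\<^esub>)\<close> appears.\<close>

section \<open>Subsets with bounded sum\<close>

definition subset_sum_count :: "nat set \<Rightarrow> nat \<Rightarrow> nat" where
  "subset_sum_count A x = card {S. finite S \<and> S \<subseteq> A \<and> \<Sum>S \<le> x}"

lemma bounded_sum_subset_atMost:
  fixes S :: "nat set"
  assumes "finite S" "\<Sum>S \<le> x"
  shows "S \<subseteq> {..x}"
  using assms member_le_sum[of _ S "\<lambda>s. s"] by fastforce

lemma finite_bounded_sum_sets: "finite {S :: nat set. finite S \<and> P S \<and> \<Sum>S \<le> x}"
  by (rule finite_subset[of _ "Pow {..x}"]) (use bounded_sum_subset_atMost in blast, simp)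

lemma subset_sum_count_cong:
  assumes "A \<inter> {..x} = B \<inter> {..x}"
  shows "subset_sum_count A x = subset_sum_count B x"
proof -
  have "S \<subseteq> A \<longleftrightarrow> S \<subseteq> B" if "finite S" "\<Sum>S \<le> x" for S
    using bounded_sum_subset_atMost[OF that] assms by blast
  then have "{S. finite S \<and> S \<subseteq> A \<and> \<Sum>S \<le> x} = {S. finite S \<and> S \<subseteq> B \<and> \<Sum>S \<le> x}"
    by blast
  then show ?thesis by (simp add: subset_sum_count_def)
qed

lemma subset_sum_count_full:
  assumes "finite A" "\<Sum>A \<le> x"
  shows "subset_sum_count A x = 2 ^ card A"
proof -
  have "finite S \<and> \<Sum>S \<le> x" if "S \<subseteq> A" for S
    using finite_subset[OF that assms(1)] sum_mono2[OF assms(1) that, of "\<lambda>s. s"] assms(2)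
    by simp
  then have "{S. finite S \<and> S \<subseteq> A \<and> \<Sum>S \<le> x} = Pow A" by blast
  then show ?thesis by (simp add: subset_sum_count_def card_Pow assms(1))
qed

lemma subset_sum_count_insert:
  assumes "a \<notin> A"
  shows "subset_sum_count (insert a A) x =
    subset_sum_count A x + (if a \<le> x then subset_sum_count A (x - a) else 0)"
proof -
  let ?without = "{S. finite S \<and> S \<subseteq> A \<and> \<Sum>S \<le> x}"
  let ?with = "{S. finite S \<and> (a \<in> S \<and> S \<subseteq> insert a A) \<and> \<Sum>S \<le> x}"
  have "{S. finite S \<and> S \<subseteq> insert a A \<and> \<Sum>S \<le> x} = ?without \<union> ?with"
    by blast
  moreover have "card (?without \<union> ?with) = card ?without + card ?with"
    by (rule card_Un_disjoint[OF finite_bounded_sum_sets finite_bounded_sum_sets])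
      (use assms in blast)
  ultimately have "subset_sum_count (insert a A) x = subset_sum_count A x + card ?with"
    by (simp only: subset_sum_count_def)
  also have "card ?with = card {S. finite S \<and> S \<subseteq> A \<and> a + \<Sum>S \<le> x}"
  proof (rule bij_betw_same_card, rule bij_betw_byWitness)
    show "(\<lambda>S. S - {a}) ` ?with \<subseteq> {S. finite S \<and> S \<subseteq> A \<and> a + \<Sum>S \<le> x}"
      by (auto simp flip: sum.remove[where g = "\<lambda>s. s"])
    show "insert a ` {S. finite S \<and> S \<subseteq> A \<and> a + \<Sum>S \<le> x} \<subseteq> ?with"
      using assms by (auto simp: sum.insert_if)
  qed (use assms in auto)
  also have "\<dots> = (if a \<le> x then subset_sum_count A (x - a) else 0)"
    by (auto simp: subset_sum_count_def le_diff_conv2 add.commute)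
  finally show ?thesis .
qed

lemma card_strict_sorted_lists_sum:
  fixes A :: "'a :: {linorder, comm_monoid_add} set"
  shows "card {xs. sorted_wrt (<) xs \<and> set xs \<subseteq> A \<and> sum_list xs = n} =
    card {S. finite S \<and> S \<subseteq> A \<and> \<Sum>S = n}"
  by (rule bij_betw_same_card[of set], rule bij_betw_byWitness[where f' = sorted_list_of_set])
    (auto simp: strict_sorted_iff sorted_list_of_set.idem_if_sorted_distinct
      distinct_sum_list_conv_Sum)

lemma fib_A_eq_subset_sum_count: "fib_A (int x) = subset_sum_count fib_numbers x"
proof -
  let ?T = "\<lambda>n. {S. finite S \<and> S \<subseteq> fib_numbers \<and> \<Sum>S = n}"
  have "finite (?T n)" for n
    by (rule finite_subset[OF _ finite_bounded_sum_sets[of "\<lambda>_. True" n]]) auto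
  moreover have "fib_A (int x) = (\<Sum>n = 0..x. fib_R n)"
    unfolding fib_A_def by (rule sum.reindex_bij_witness[of _ int nat]) auto
  ultimately have "fib_A (int x) = card (\<Union>n\<in>{0..x}. ?T n)"
    unfolding fib_R_def card_strict_sorted_lists_sum by (subst card_UN_disjoint) auto
  also have "(\<Union>n\<in>{0..x}. ?T n) = {S. finite S \<and> S \<subseteq> fib_numbers \<and> \<Sum>S \<le> x}"
    by auto
  finally show ?thesis by (simp add: subset_sum_count_def)
qed

section \<open>Subsets of Fibonacci numbers with bounded index\<close>

lemma strict_mono_on_fib: "strict_mono_on {2..} fib"
proof (rule strict_mono_onI)
  fix i j :: nat
  assume "i \<in> {2..}" "i < j"
  then have "fib i < fib (Suc i)" by (cases i) (auto simp: fib_neq_0_nat)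
  also have "\<dots> \<le> fib j" using \<open>i < j\<close> by (intro fib_mono) simp
  finally show "fib i < fib j" .
qed

lemma inj_on_fib: "inj_on fib {2..}"
  using strict_mono_on_fib by (rule strict_mono_on_imp_inj_on)

lemma sum_fib: "2 \<le> m \<Longrightarrow> (\<Sum>i = 2..<m. fib i) + 2 = fib (Suc m)"
  by (induction m rule: nat_induct_at_least) (auto simp: numeral_2_eq_2)

lemma fib_numbers_eq: "fib_numbers = fib ` {2..}"
proof -
  have "{1..} = insert 1 {2 :: nat..}" by auto
  moreover have "fib 1 \<in> fib ` {2..}" by (rule image_eqI[of _ _ 2]) auto
  ultimately show ?thesis unfolding fib_numbers_def by auto
qed

definition fib_count :: "nat \<Rightarrow> nat \<Rightarrow> nat" where
  "fib_count m x = subset_sum_count (fib ` {2..<m}) x"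

lemma fib_A_eq_fib_count:
  assumes "x < fib m"
  shows "fib_A (int x) = fib_count m x"
proof -
  have "i < m" if "fib i \<le> x" for i
    using that assms fib_mono[of m i] by linarith
  then have "fib_numbers \<inter> {..x} = fib ` {2..<m} \<inter> {..x}"
    by (auto simp: fib_numbers_eq)
  then show ?thesis
    unfolding fib_A_eq_subset_sum_count fib_count_def by (rule subset_sum_count_cong)
qed

lemma fib_count_Suc:
  assumes "2 \<le> m"
  shows "fib_count (Suc m) x =
    fib_count m x + (if fib m \<le> x then fib_count m (x - fib m) else 0)"
proof -
  have "fib m \<notin> fib ` {2..<m}"
    using assms by (subst inj_on_image_mem_iff[OF inj_on_fib]) auto
  moreover have "fib ` {2..<Suc m} = insert (fib m) (fib ` {2..<m})"
    using assms by (simp add: atLeastLessThanSuc)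
  ultimately show ?thesis
    by (simp add: fib_count_def subset_sum_count_insert)
qed

lemma fib_count_full:
  assumes "2 \<le> m" "fib (Suc m) \<le> x + 2"
  shows "fib_count m x = 2 ^ (m - 2)"
proof -
  have inj: "inj_on fib {2..<m}" by (rule inj_on_subset[OF inj_on_fib]) auto
  then have "\<Sum>(fib ` {2..<m}) \<le> x"
    using sum_fib[OF assms(1)] assms(2) by (simp add: sum.reindex)
  then show ?thesis
    by (simp add: fib_count_def subset_sum_count_full card_image[OF inj])
qed

lemma fib_count_fib_add:
  assumes "2 \<le> m"
  shows "fib_count (m + 2) (fib (m + 2) + y) =
    fib_count m (fib m + y) + fib_count m y + 2 ^ (m - 1)"
proof -
  have "fib (m + 2) + y = fib (m + 1) + (fib m + y)" by simp
  then have "fib_count (m + 2) (fib (m + 2) + y) =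
      fib_count (m + 1) (fib (m + 2) + y) + fib_count (m + 1) (fib m + y)"
    using fib_count_Suc[of "m + 1" "fib (m + 2) + y"] assms by simp
  also have "fib_count (m + 1) (fib (m + 2) + y) = 2 ^ (m - 1)"
    using assms by (subst fib_count_full) auto
  also have "fib_count (m + 1) (fib m + y) = fib_count m (fib m + y) + fib_count m y"
    using fib_count_Suc[OF assms] by simp
  finally show ?thesis by simp
qed

section \<open>Recurrences for the summatory function\<close>

lemma fib_A_0: "fib_A 0 = 1"
  using fib_A_eq_fib_count[of 0 2] fib_count_full[of 2 0] by (simp add: numeral_2_eq_2)

lemma fib_A_fib_add:
  assumes "y < fib m"
  shows "fib_A (int (fib (Suc m) + y)) = fib_A (int y) + fib_count (Suc m) (fib (Suc m) + y)"
proof -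
  have "0 < m" using assms by (cases m) auto
  have "fib_A (int (fib (Suc m) + y)) = fib_count (Suc (Suc m)) (fib (Suc m) + y)"
    using assms by (intro fib_A_eq_fib_count) simp
  also have "\<dots> = fib_count (Suc m) (fib (Suc m) + y) + fib_count (Suc m) y"
    using \<open>0 < m\<close> by (simp add: fib_count_Suc)
  also have "fib_count (Suc m) y = fib_A (int y)"
    using assms fib_Suc_mono[of m] by (intro fib_A_eq_fib_count[symmetric]) linarith
  finally show ?thesis by simp
qed

lemma fib_A_fib_add_step:
  assumes "y < fib m"
  shows "fib_A (int (fib (m + 3) + y)) = fib_A (int (fib (m + 1) + y)) + fib_A (int y) + 2 ^ m"
proof -
  have "0 < m" using assms by (cases m) auto
  have "y < fib (m + 1)" "y < fib (m + 2)" using assms fib_Suc_mono[of m] by simp_all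
  then have "fib_A (int (fib (m + 3) + y)) = fib_A (int y) + fib_count (m + 3) (fib (m + 3) + y)"
    using fib_A_fib_add[of y "m + 2"] by (simp add: numeral_3_eq_3)
  also have "fib_count (m + 3) (fib (m + 3) + y) =
      fib_count (m + 1) (fib (m + 1) + y) + fib_count (m + 1) y + 2 ^ m"
    using fib_count_fib_add[of "m + 1" y] \<open>0 < m\<close> by (simp add: numeral_3_eq_3)
  also have "fib_count (m + 1) y = fib_A (int y)"
    using \<open>y < fib (m + 1)\<close> by (rule fib_A_eq_fib_count[symmetric])
  finally show ?thesis using fib_A_fib_add[OF assms] by simp
qed

lemma fib_A_fib_add_iterate:
  assumes "y < fib m"
  shows "real (fib_A (int (fib (m + 1 + 2 * s) + y))) =
    real (fib_A (int (fib (m + 1) + y))) + real s * real (fib_A (int y)) + 2 ^ m * (4 ^ s - 1) / 3"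
proof (induction s)
  case (Suc s)
  have less: "y < fib (m + 2 * s)"
    using assms fib_mono[of m "m + 2 * s"] by simp
  have index: "m + 1 + 2 * Suc s = m + 2 * s + 3" "m + 1 + 2 * s = m + 2 * s + 1" by simp_all
  have "real (fib_A (int (fib (m + 1 + 2 * Suc s) + y))) =
      real (fib_A (int (fib (m + 1 + 2 * s) + y))) + real (fib_A (int y)) + 2 ^ m * 4 ^ s"
    unfolding index fib_A_fib_add_step[OF less] by (simp add: power_add power_mult)
  also note Suc.IH
  finally show ?case by (simp add: field_simps)
qed simp

lemma fib_A_fib_add_gap_two:
  assumes "z < fib (q + 1)" and y_eq: "y = fib (q + 2) + z"
  shows "fib_A (int (fib (q + 4) + y)) + fib_A (int z) = 2 * fib_A (int y) + 3 * 2 ^ q"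
proof -
  have "y < fib (q + 3)" using assms by (simp add: numeral_3_eq_3)
  then have "fib_A (int (fib (q + 4) + y)) = fib_A (int y) + fib_count (q + 4) (fib (q + 4) + y)"
    using fib_A_fib_add[of y "q + 3"] by (simp add: eval_nat_numeral)
  also have "fib_count (q + 4) (fib (q + 4) + y) =
      fib_count (q + 2) (fib (q + 2) + y) + fib_count (q + 2) y + 2 ^ (q + 1)"
    using fib_count_fib_add[of "q + 2" y] by (simp add: eval_nat_numeral)
  also have "fib_count (q + 2) (fib (q + 2) + y) = 2 ^ q"
    by (subst fib_count_full) (auto simp: y_eq)
  finally show ?thesis
    using fib_A_fib_add[OF assms(1)] by (simp add: y_eq)
qed

lemma fib_A_fib_add_gap_three:
  assumes "z < fib (q + 1)" and y_eq: "y = fib (q + 2) + z"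
  shows "fib_A (int (fib (q + 5) + y)) = 2 * fib_A (int y) + 3 * 2 ^ (q + 1)"
proof -
  have less: "y < fib (q + 3)" using assms by (simp add: numeral_3_eq_3)
  then have "y < fib (q + 4)" using fib_Suc_mono[of "q + 3"] by (simp add: eval_nat_numeral)
  then have "fib_A (int (fib (q + 5) + y)) = fib_A (int y) + fib_count (q + 5) (fib (q + 5) + y)"
    using fib_A_fib_add[of y "q + 4"] by (simp add: eval_nat_numeral)
  also have "fib_count (q + 5) (fib (q + 5) + y) =
      fib_count (q + 3) (fib (q + 3) + y) + fib_count (q + 3) y + 2 ^ (q + 2)"
    using fib_count_fib_add[of "q + 3" y] by (simp add: eval_nat_numeral)
  also have "fib_count (q + 3) (fib (q + 3) + y) = 2 ^ (q + 1)"
    by (subst fib_count_full) (auto simp: y_eq eval_nat_numeral)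
  also have "fib_count (q + 3) y = fib_A (int y)"
    using less by (rule fib_A_eq_fib_count[symmetric])
  finally show ?thesis by simp
qed

lemma fib_A_fib_add_even_gap:
  assumes "1 \<le> s" and z_less: "z < fib (q + 1)" and y_eq: "y = fib (q + 2) + z"
  shows "real (fib_A (int (fib (q + 2 + 2 * s) + y))) =
    (real s + 1) * real (fib_A (int y)) - real (fib_A (int z)) + zeck_f (s + 1) * 2 ^ q"
proof -
  obtain r where s: "s = Suc r" using assms(1) by (cases s) auto
  have "y < fib (q + 3)" using z_less y_eq by (simp add: numeral_3_eq_3)
  then have "real (fib_A (int (fib (q + 2 + 2 * s) + y))) =
      real (fib_A (int (fib (q + 4) + y))) + real r * real (fib_A (int y))
      + 2 ^ (q + 3) * (4 ^ r - 1) / 3"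
    using fib_A_fib_add_iterate[of y "q + 3" r] by (simp add: s eval_nat_numeral)
  moreover have "real (fib_A (int (fib (q + 4) + y))) + real (fib_A (int z)) =
      2 * real (fib_A (int y)) + 3 * 2 ^ q"
    using arg_cong[OF fib_A_fib_add_gap_two[OF z_less y_eq], of real] by simp
  ultimately show ?thesis
    by (simp add: s zeck_f_def field_simps power_add)
qed

lemma fib_A_fib_add_odd_gap:
  assumes "1 \<le> s" and z_less: "z < fib (q + 1)" and y_eq: "y = fib (q + 2) + z"
  shows "real (fib_A (int (fib (q + 3 + 2 * s) + y))) =
    (real s + 1) * real (fib_A (int y)) + zeck_f (s + 1) * 2 ^ (q + 1)"
proof -
  obtain r where s: "s = Suc r" using assms(1) by (cases s) auto
  have "y < fib (q + 4)"
    using z_less y_eq fib_mono[of "q + 1" "q + 3"] by (simp add: eval_nat_numeral)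
  then have "real (fib_A (int (fib (q + 3 + 2 * s) + y))) =
      real (fib_A (int (fib (q + 5) + y))) + real r * real (fib_A (int y))
      + 2 ^ (q + 4) * (4 ^ r - 1) / 3"
    using fib_A_fib_add_iterate[of y "q + 4" r] by (simp add: s eval_nat_numeral)
  also have "real (fib_A (int (fib (q + 5) + y))) = 2 * real (fib_A (int y)) + 3 * 2 ^ (q + 1)"
    using arg_cong[OF fib_A_fib_add_gap_three[OF z_less y_eq], of real] by simp
  finally show ?thesis
    by (simp add: s zeck_f_def field_simps power_add)
qed

lemma fib_A_fib_add_fib_add:
  assumes "2 \<le> n" "2 \<le> d" "z < fib (n - 1)" and t_eq: "t = (d + 2) div 2"
  shows "real (fib_A (int (fib (n + d) + (fib n + z)))) =
    real t * real (fib_A (int (fib n + z)))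
    - (2 * real t - 1 - real d) * real (fib_A (int z))
    + zeck_f t * 2 powi (int (n + d) - 2 * int t)"
proof -
  obtain q where n_eq: "n = q + 2" using assms(1) by (metis add.commute le_Suc_ex)
  have z_less: "z < fib (q + 1)" using assms(3) n_eq by simp
  consider (even) s where "d = 2 * s" | (odd) s where "d = 2 * s + 1" by (meson evenE oddE)
  then show ?thesis
  proof cases
    case (even s)
    have "int (n + d) - 2 * int t = int q" and "t = s + 1" using t_eq n_eq even by simp_all
    then have pow: "2 powi (int (n + d) - 2 * int t) = (2 :: real) ^ q"
      by (simp only: power_int_of_nat)
    show ?thesis
      unfolding pow
      using fib_A_fib_add_even_gap[OF _ z_less refl, of s] even n_eq assms(2) \<open>t = s + 1\<close>
      by simp
  next
    case (odd s)
    have "int (n + d) - 2 * int t = int (q + 1)" and "t = s + 1" using t_eq n_eq odd by simp_all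
    then have pow: "2 powi (int (n + d) - 2 * int t) = (2 :: real) ^ (q + 1)"
      by (simp only: power_int_of_nat)
    show ?thesis
      unfolding pow
      using fib_A_fib_add_odd_gap[OF _ z_less refl, of s] odd n_eq assms(2) \<open>t = s + 1\<close>
      by (simp add: numeral_3_eq_3)
  qed
qed

lemma fib_A_fib:
  assumes "2 \<le> n"
  shows "int (fib_A (int (fib n))) = \<lfloor>2 ^ n / 6 + (real n + 1) / 2\<rfloor>"
proof -
  have fib_A_1: "fib_A 1 = 2"
    using fib_A_fib_add[of 0 1] fib_count_full[of 2 1] by (simp add: fib_A_0 numeral_2_eq_2)
  have fib_A_2: "fib_A 2 = 3"
    using fib_A_fib_add[of 0 2] fib_count_full[of 3 2] by (simp add: fib_A_0 eval_nat_numeral)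
  consider (even) s where "n = 2 + 2 * s" | (odd) s where "n = 3 + 2 * s"
  proof -
    have "n = 2 + 2 * ((n - 2) div 2) \<or> n = 3 + 2 * ((n - 2) div 2)" using assms by arith
    then show ?thesis using that by blast
  qed
  then show ?thesis
  proof cases
    case (even s)
    have "real (fib_A (int (fib n))) = 2 + real s + 2 * (4 ^ s - 1) / 3"
      using fib_A_fib_add_iterate[of 0 1 s] by (simp add: even fib_A_0 fib_A_1)
    moreover have "(2 :: real) ^ n = 4 * 4 ^ s" by (simp add: even power_add power_mult)
    moreover have "real n = 2 + 2 * real s" by (simp add: even)
    ultimately have "2 ^ n / 6 + (real n + 1) / 2 = real (fib_A (int (fib n))) + 1 / 6"
      by (simp add: field_simps)
    then show ?thesis by (intro floor_unique[symmetric]) auto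
  next
    case (odd s)
    have "real (fib_A (int (fib n))) = 3 + real s + 4 * (4 ^ s - 1) / 3"
      using fib_A_fib_add_iterate[of 0 2 s] by (simp add: odd fib_A_0 fib_A_2 numeral_3_eq_3)
    moreover have "(2 :: real) ^ n = 8 * 4 ^ s" by (simp add: odd power_add power_mult)
    moreover have "real n = 3 + 2 * real s" by (simp add: odd)
    ultimately have "2 ^ n / 6 + (real n + 1) / 2 = real (fib_A (int (fib n))) + 1 / 3"
      by (simp add: field_simps)
    then show ?thesis by (intro floor_unique[symmetric]) auto
  qed
qed

section \<open>Zeckendorf expansions\<close>

lemma zeck_t_eq:
  assumes "m i \<le> m (i - 1)"
  shows "zeck_t m i = (m (i - 1) - m i + 2) div 2"
proof -
  have "(real (m (i - 1)) - real (m i) + 2) / 2 = real (m (i - 1) - m i + 2) / real 2"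
    using assms by (simp add: of_nat_diff)
  then show ?thesis
    unfolding zeck_t_def by (simp only: floor_divide_of_nat_eq nat_int)
qed

lemma zeck_x_Suc: "i \<le> k \<Longrightarrow> zeck_x m k i = fib (m i) + zeck_x m k (Suc i)"
  by (simp add: zeck_x_def sum.atLeast_Suc_atMost)

text \<open>The \<open>a\<^sub>l\<close> are the coefficients that arise on eliminating \<open>u\<^sub>1, \<dots>, u\<^bsub>l-1\<^esub>\<close>.\<close>

lemma zeck_a_elimination:
  fixes u v :: "nat \<Rightarrow> 'a :: comm_ring_1"
  assumes rec: "\<And>i. i < k \<Longrightarrow> u i =
      of_nat (zeck_t m (Suc i)) * u (Suc i) - of_int (zeck_eps m (Suc i)) * u (Suc (Suc i))
      + v (Suc i)"
    and "1 \<le> l" "l \<le> k"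
  shows "u 0 =
    of_int (zeck_a m l) * u l - of_int (zeck_eps m l) * of_int (zeck_a m (l - 1)) * u (l + 1)
    + (\<Sum>i = 1..l. of_int (zeck_a m (i - 1)) * v i)"
  using \<open>1 \<le> l\<close> \<open>l \<le> k\<close>
proof (induction l rule: nat_induct_at_least)
  case base
  then show ?case using rec[of 0] by simp
next
  case (Suc l)
  have a_Suc: "zeck_a m (Suc l) =
      int (zeck_t m (Suc l)) * zeck_a m l - zeck_eps m l * zeck_a m (l - 1)"
    using Suc.hyps by (cases l) auto
  have "u 0 =
      of_int (zeck_a m l) * u l - of_int (zeck_eps m l) * of_int (zeck_a m (l - 1)) * u (l + 1)
      + (\<Sum>i = 1..l. of_int (zeck_a m (i - 1)) * v i)"
    using Suc by simp
  also have "u l = of_nat (zeck_t m (Suc l)) * u (Suc l)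
      - of_int (zeck_eps m (Suc l)) * u (Suc (Suc l)) + v (Suc l)"
    using rec Suc.prems by simp
  finally show ?case by (simp add: a_Suc algebra_simps)
qed

locale zeckendorf_expansion =
  fixes m :: "nat \<Rightarrow> nat" and k :: nat
  assumes index_gap: "i < k \<Longrightarrow> m (Suc i) + 2 \<le> m i"
    and last_index_ge_2: "2 \<le> m k"
begin

lemma index_ge_2: "i \<le> k \<Longrightarrow> 2 \<le> m i"
  by (induction i rule: inc_induct) (use last_index_ge_2 index_gap in force)+

lemma zeck_x_Suc_less: "i \<le> k \<Longrightarrow> zeck_x m k (Suc i) < fib (m i - 1)"
proof (induction i rule: inc_induct)
  case base
  then show ?case using last_index_ge_2 by (simp add: zeck_x_def fib_neq_0_nat)
next
  case (step i)
  have "zeck_x m k (Suc i) < fib (m (Suc i)) + fib (m (Suc i) - 1)"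
    using step by (simp add: zeck_x_Suc)
  also have "\<dots> = fib (Suc (m (Suc i)))"
    using index_ge_2[of "Suc i"] step.hyps by (cases "m (Suc i)") auto
  also have "\<dots> \<le> fib (m i - 1)" using index_gap[of i] step.hyps by (intro fib_mono) simp
  finally show ?case .
qed

lemma fib_A_zeck_x_rec:
  assumes "i < k"
  shows "real (fib_A (int (zeck_x m k i))) =
    real (zeck_t m (Suc i)) * real (fib_A (int (zeck_x m k (Suc i))))
    - real_of_int (zeck_eps m (Suc i)) * real (fib_A (int (zeck_x m k (Suc (Suc i)))))
    + zeck_f (zeck_t m (Suc i)) * 2 powi (int (m i) - 2 * int (zeck_t m (Suc i)))"
proof -
  define d where "d = m i - m (Suc i)"
  have m_eq: "m i = m (Suc i) + d" and d_ge_2: "2 \<le> d"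
    using index_gap[OF assms] by (simp_all add: d_def)
  have t_eq: "zeck_t m (Suc i) = (d + 2) div 2" using m_eq by (simp add: zeck_t_eq)
  have "real_of_int (zeck_eps m (Suc i)) = 2 * real (zeck_t m (Suc i)) - 1 - real d"
    by (simp add: zeck_eps_def m_eq)
  then show ?thesis
    using fib_A_fib_add_fib_add[OF index_ge_2 d_ge_2 zeck_x_Suc_less t_eq] assms
    by (simp add: zeck_x_Suc m_eq)
qed

lemma fib_A_zeck_x_0:
  assumes "1 \<le> l" "l \<le> k"
  shows "real (fib_A (int (zeck_x m k 0))) =
    real_of_int (zeck_a m l) * real (fib_A (int (zeck_x m k l)))
    - real_of_int (zeck_eps m l) * real_of_int (zeck_a m (l - 1))
        * real (fib_A (int (zeck_x m k (l + 1))))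
    + zeck_sum m l"
  unfolding zeck_sum_def mult.assoc[of _ "zeck_f _"] using assms
  by (intro zeck_a_elimination[where k = k and u = "\<lambda>i. real (fib_A (int (zeck_x m k i)))"])
    (simp_all add: fib_A_zeck_x_rec)

lemma fib_A_zeck_x_last:
  "real (fib_A (int (zeck_x m k k))) = real_of_int \<lfloor>2 ^ m k / 6 + (real (m k) + 1) / 2\<rfloor>"
  using arg_cong[OF fib_A_fib[OF last_index_ge_2], of real_of_int] by (simp add: zeck_x_def)

lemma fib_A_zeck_x_0_closed_form:
  assumes "1 \<le> k"
  shows "real (fib_A (int (zeck_x m k 0))) =
    real_of_int (zeck_a m k) * real_of_int \<lfloor>2 ^ m k / 6 + (real (m k) + 1) / 2\<rfloor>
    - real_of_int (zeck_eps m k) * real_of_int (zeck_a m (k - 1)) + zeck_sum m k"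
proof -
  have "fib_A (int (zeck_x m k (k + 1))) = 1" by (simp add: zeck_x_def fib_A_0)
  then show ?thesis
    unfolding fib_A_zeck_x_0[OF assms order_refl] fib_A_zeck_x_last by simp
qed

end

theorem theorem1p2:
  fixes H k :: nat and m :: "nat \<Rightarrow> nat"
  assumes "H = (\<Sum>i = 0..k. fib (m i))"
    and "\<And>i. 1 \<le> i \<Longrightarrow> i \<le> k \<Longrightarrow> int (m (i - 1)) - int (m i) \<ge> 2"
    and "m k \<ge> 2"
  shows "(\<forall>l. 1 \<le> l \<and> l \<le> k \<longrightarrow>
            real (fib_A (int H)) =
              real_of_int (zeck_a m l) * real (fib_A (int (zeck_x m k l)))
              - real_of_int (zeck_eps m l) * real_of_int (zeck_a m (l - 1))
                  * real (fib_A (int (zeck_x m k (l + 1))))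
              + zeck_sum m l)
       \<and> real (fib_A (int H)) =
           (if k \<ge> 1 then
              real_of_int (zeck_a m k) * real_of_int \<lfloor>2 ^ m k / 6 + (real (m k) + 1) / 2\<rfloor>
              - real_of_int (zeck_eps m k) * real_of_int (zeck_a m (k - 1))
              + zeck_sum m k
            else real_of_int \<lfloor>2 ^ m 0 / 6 + (real (m 0) + 1) / 2\<rfloor>)"
proof -
  interpret zeckendorf_expansion m k
  proof
    show "m (Suc i) + 2 \<le> m i" if "i < k" for i
      using assms(2)[of "Suc i"] that by simp
  qed (rule assms(3))
  have H_eq: "H = zeck_x m k 0" using assms(1) by (simp add: zeck_x_def)
  show ?thesis
    unfolding H_eq
    using fib_A_zeck_x_0 fib_A_zeck_x_0_closed_form fib_A_zeck_x_last by (cases "k = 0") simp_all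
qed

end
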